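(* Consider problem (NSOCP) and let $\bar{x}$ be a feasible point. If weak-Robinson's CQ holds at $\bar{x}$ (for the whole system of constraints $g_1(x)\in\mathbb{L}_{m_1},\dots,g_q(x)\in\mathbb{L}_{m_q}$), then for each index $j\in\{1,\dots,q\}$ the point $\bar{x}$ satisfies Robinson's CQ for the isolated constraint $g_j(x)\in\mathbb{L}_{m_j}$.
   Context: Norms are Euclidean. For $m\ge 2$ write $y=(y_0,\widehat{y})\in\mathbb{R}\times\mathbb{R}^{m-1}$, and let $\mathbb{L}_m=\{y\in\mathbb{R}^m: y_0\ge\|\widehat{y}\|\}$ be the second-order cone. Let $\mathrm{bd}_+\mathbb{L}_m$ be its boundary minus the origin. Problem (NSOCP): minimize $f(x)$ over $x\in\mathbb{R}^n$ subject to $g_j(x)\in\mathbb{L}_{m_j}$, $j=1,\dots,q$, where $f:\mathbb{R}^n\to\mathbb{R}$ and $g_j=(g_{j,0},\widehat{g}_j):\mathbb{R}^n\to\mathbb{R}^{m_j}$ are continuously differentiable and $m_j\ge 2$ for all $j$. $D$ denotes the Jacobian matrix. For feasible $x$: $I_0(x)=\{j: g_j(x)=0\}$, $I_B(x)=\{j: g_j(x)\in\mathrm{bd}_+\mathbb{L}_{m_j}\}$. Eigenvectors: for $y\in\mathbb{R}^m$, $u_1(y)=\frac12(1,-w)$ and $u_2(y)=\frac12(1,w)$, where $w=\widehat{y}/\|\widehat{y}\|$ if $\widehat{y}\ne0$, and $w\in\mathbb{R}^{m-1}$ is any unit vector (free choice, the same $w$ for $u_1$ and $u_2$) if $\widehat{y}=0$.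 Let $\Gamma_j=\begin{bmatrix}1&0\\0&-\mathbb{I}_{m_j-1}\end{bmatrix}$, where $\mathbb{I}_{m_j-1}$ is the identity matrix. Robinson's CQ holds at $\bar{x}$ for a system of constraints $g_j(x)\in\mathbb{L}_{m_j}$, $j\in J$, if the only solution of $$\sum_{j\in I_B(\bar{x})\cap J}a_j\,Dg_j(\bar{x})^\top\Gamma_j g_j(\bar{x})+\sum_{j\in I_0(\bar{x})\cap J}Dg_j(\bar{x})^\top v_j=0,\qquad a_j\ge0,\ v_j\in\mathbb{L}_{m_j},$$ is $a_j=0$, $v_j=0$ for all $j$. For an isolated constraint, $J$ is a singleton. A finite (indexed) family of vectors is positively linearly independent if no linear combination of it with nonnegative coefficients, not all zero, vanishes. Weak-Robinson's CQ holds at $\bar{x}$ if, for each sequence $x^k\to\bar{x}$ in $\mathbb{R}^n$, there exist an infinite set $I\subseteq\mathbb{N}$ and (a choice of) eigenvector sequences converging along $k\in I$, $u_1(g_j(x^k))\to\frac12(1,-\bar{w}_j)$ and $u_2(g_j(x^k))\to\frac12(1,\bar{w}_j)$ with $\|\bar{w}_j\|=1$, for every $j\in I_0(\bar{x})$, such that the family $$\left\{Dg_{j}(\bar{x})^\top u_1(g_{j}(\bar{x}))\right\}_{j\in I_B(\bar{x})}\cup\left\{ Dg_{j}(\bar{x})^\top (1,-\bar{w}_{j}),\ Dg_{j}(\bar{x})^\top (1,\bar{w}_{j}) \right\}_{j\in I_0(\bar{x})}$$ is positively linearly independent. *)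

theory Defs
  imports "HOL-Analysis.Analysis"
begin

text \<open>
  The dimensions of the constraint spaces depend on the constraint index, so a vector of
  dimension \<open>m\<close> is an element of \<^term>\<open>topspace (Euclidean_space m)\<close>: a function
  \<open>nat \<Rightarrow> real\<close> that vanishes from index \<open>m\<close> on. The zero vector is \<open>\<lambda>_. 0\<close>.
  The vector written \<open>(a, w)\<close> in block form is \<^term>\<open>case_nat a w\<close>.
\<close>

definition enorm :: "nat \<Rightarrow> (nat \<Rightarrow> real) \<Rightarrow> real"
  where "enorm m y = L2_set y {..<m}"

definition hat :: "(nat \<Rightarrow> real) \<Rightarrow> nat \<Rightarrow> real"
  where "hat y = (\<lambda>i. y (Suc i))"

definition soc :: "nat \<Rightarrow> (nat \<Rightarrow> real) set"
  where "soc m = {y \<in> topspace (Euclidean_space m). enorm (m - 1) (hat y) \<le> y 0}"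

definition soc_bd_plus :: "nat \<Rightarrow> (nat \<Rightarrow> real) set"
  where "soc_bd_plus m = (Euclidean_space m frontier_of soc m) - {\<lambda>_. 0}"

definition unit_vectors :: "nat \<Rightarrow> (nat \<Rightarrow> real) set"
  where "unit_vectors m = {w \<in> topspace (Euclidean_space m). enorm m w = 1}"

definition u1 :: "(nat \<Rightarrow> real) \<Rightarrow> nat \<Rightarrow> real"
  where "u1 w = (\<lambda>i. 1/2 * case_nat 1 (\<lambda>l. - w l) i)"

definition u2 :: "(nat \<Rightarrow> real) \<Rightarrow> nat \<Rightarrow> real"
  where "u2 w = (\<lambda>i. 1/2 * case_nat 1 w i)"

definition normalized_hat :: "nat \<Rightarrow> (nat \<Rightarrow> real) \<Rightarrow> nat \<Rightarrow> real"
  where "normalized_hat m y = (\<lambda>i. hat y i / enorm (m - 1) (hat y))"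

text \<open>
  The admissible \<open>w\<close> in the eigenvectors \<^term>\<open>u1 w\<close>, \<^term>\<open>u2 w\<close> of \<open>y\<close>; it is a
  singleton unless \<^term>\<open>hat y\<close> vanishes.
\<close>

definition eig_dirs :: "nat \<Rightarrow> (nat \<Rightarrow> real) \<Rightarrow> (nat \<Rightarrow> real) set"
  where "eig_dirs m y =
    (if hat y \<noteq> (\<lambda>_. 0) then {normalized_hat m y} else unit_vectors (m - 1))"

definition grad :: "(real^'n \<Rightarrow> real) \<Rightarrow> real^'n \<Rightarrow> real^'n"
  where "grad h x = (\<chi> k. frechet_derivative h (at x) (axis k 1))"

definition cont_diff :: "(real^'n \<Rightarrow> real) \<Rightarrow> bool"
  where "cont_diff h \<longleftrightarrow> (\<forall>x. h differentiable (at x)) \<and> continuous_on UNIV (grad h)"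

definition cont_diff_map :: "nat \<Rightarrow> (real^'n \<Rightarrow> nat \<Rightarrow> real) \<Rightarrow> bool"
  where "cont_diff_map m G \<longleftrightarrow>
    (\<forall>x. G x \<in> topspace (Euclidean_space m)) \<and> (\<forall>i<m. cont_diff (\<lambda>x. G x i))"

text \<open>\<open>Jac G x i $ k\<close> is the entry of the Jacobian matrix in row \<open>i\<close> and column \<open>k\<close>.\<close>

definition Jac :: "(real^'n \<Rightarrow> nat \<Rightarrow> real) \<Rightarrow> real^'n \<Rightarrow> nat \<Rightarrow> real^'n"
  where "Jac G x i = grad (\<lambda>z. G z i) x"

definition JacT_mult ::
    "nat \<Rightarrow> (real^'n \<Rightarrow> nat \<Rightarrow> real) \<Rightarrow> real^'n \<Rightarrow> (nat \<Rightarrow> real) \<Rightarrow> real^'n"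
  where "JacT_mult m G x v = (\<chi> k. \<Sum>i<m. Jac G x i $ k * v i)"

definition Gamma_mat :: "nat \<Rightarrow> nat \<Rightarrow> real"
  where "Gamma_mat i l = (if i \<noteq> l then 0 else if i = 0 then 1 else -1)"

definition Gamma_mult :: "nat \<Rightarrow> (nat \<Rightarrow> real) \<Rightarrow> nat \<Rightarrow> real"
  where "Gamma_mult m y = (\<lambda>i. \<Sum>l<m. Gamma_mat i l * y l)"

text \<open>
  In the following, \<open>J\<close> is the index set of the system of constraints
  \<open>g j x \<in> soc (m j)\<close>, \<open>j \<in> J\<close>.
\<close>

definition feasible ::
    "nat set \<Rightarrow> (nat \<Rightarrow> nat) \<Rightarrow> (nat \<Rightarrow> real^'n \<Rightarrow> nat \<Rightarrow> real) \<Rightarrow> real^'n \<Rightarrow> bool"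
  where "feasible J m g x \<longleftrightarrow> (\<forall>j\<in>J. g j x \<in> soc (m j))"

definition I0 :: "nat set \<Rightarrow> (nat \<Rightarrow> real^'n \<Rightarrow> nat \<Rightarrow> real) \<Rightarrow> real^'n \<Rightarrow> nat set"
  where "I0 J g x = {j \<in> J. g j x = (\<lambda>_. 0)}"

definition IB ::
    "nat set \<Rightarrow> (nat \<Rightarrow> nat) \<Rightarrow> (nat \<Rightarrow> real^'n \<Rightarrow> nat \<Rightarrow> real) \<Rightarrow> real^'n \<Rightarrow> nat set"
  where "IB J m g x = {j \<in> J. g j x \<in> soc_bd_plus (m j)}"

definition robinson_cq ::
    "nat set \<Rightarrow> (nat \<Rightarrow> nat) \<Rightarrow> (nat \<Rightarrow> real^'n \<Rightarrow> nat \<Rightarrow> real) \<Rightarrow> real^'n \<Rightarrow> bool"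
  where "robinson_cq J m g x \<longleftrightarrow>
    (\<forall>(a :: nat \<Rightarrow> real) (v :: nat \<Rightarrow> nat \<Rightarrow> real).
       (\<forall>j\<in>IB J m g x. a j \<ge> 0) \<and>
       (\<forall>j\<in>I0 J g x. v j \<in> soc (m j)) \<and>
       (\<Sum>j\<in>IB J m g x. a j *\<^sub>R JacT_mult (m j) (g j) x (Gamma_mult (m j) (g j x)))
         + (\<Sum>j\<in>I0 J g x. JacT_mult (m j) (g j) x (v j)) = 0
       \<longrightarrow> (\<forall>j\<in>IB J m g x. a j = 0) \<and> (\<forall>j\<in>I0 J g x. v j = (\<lambda>_. 0)))"

definition pos_lin_indep :: "'i set \<Rightarrow> ('i \<Rightarrow> 'a::real_vector) \<Rightarrow> bool"
  where "pos_lin_indep S V \<longleftrightarrow>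
    (\<forall>c :: 'i \<Rightarrow> real. (\<forall>s\<in>S. c s \<ge> 0) \<and> (\<Sum>s\<in>S. c s *\<^sub>R V s) = 0 \<longrightarrow> (\<forall>s\<in>S. c s = 0))"

text \<open>
  The family in weak-Robinson's CQ, indexed by the disjoint sum \<open>IB <+> (I0 <+> I0)\<close>, so
  that repeated vectors count with multiplicity. For \<open>j \<in> IB\<close> the vector
  \<^term>\<open>hat (g j x)\<close> is nonzero, so that \<^const>\<open>normalized_hat\<close> gives the unique
  admissible direction there.
\<close>

definition wr_family ::
    "(nat \<Rightarrow> nat) \<Rightarrow> (nat \<Rightarrow> real^'n \<Rightarrow> nat \<Rightarrow> real) \<Rightarrow> real^'n \<Rightarrow> (nat \<Rightarrow> nat \<Rightarrow> real)
      \<Rightarrow> nat + nat + nat \<Rightarrow> real^'n"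
  where "wr_family m g x wbar =
    case_sum (\<lambda>j. JacT_mult (m j) (g j) x (u1 (normalized_hat (m j) (g j x))))
      (case_sum (\<lambda>j. JacT_mult (m j) (g j) x (case_nat 1 (\<lambda>i. - wbar j i)))
                (\<lambda>j. JacT_mult (m j) (g j) x (case_nat 1 (wbar j))))"

text \<open>The filter \<^term>\<open>inf sequentially (principal I)\<close> expresses convergence along \<open>k \<in> I\<close>.\<close>

definition weak_robinson_cq ::
    "nat set \<Rightarrow> (nat \<Rightarrow> nat) \<Rightarrow> (nat \<Rightarrow> real^'n \<Rightarrow> nat \<Rightarrow> real) \<Rightarrow> real^'n \<Rightarrow> bool"
  where "weak_robinson_cq J m g xbar \<longleftrightarrow>
    (\<forall>x :: nat \<Rightarrow> real^'n. x \<longlonglongrightarrow> xbar \<longrightarrow>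
      (\<exists>(I :: nat set) (w :: nat \<Rightarrow> nat \<Rightarrow> nat \<Rightarrow> real) (wbar :: nat \<Rightarrow> nat \<Rightarrow> real).
         infinite I \<and>
         (\<forall>j\<in>I0 J g xbar.
            (\<forall>k\<in>I. w j k \<in> eig_dirs (m j) (g j (x k))) \<and>
            wbar j \<in> unit_vectors (m j - 1) \<and>
            limitin (Euclidean_space (m j)) (\<lambda>k. u1 (w j k)) (u1 (wbar j))
              (inf sequentially (principal I)) \<and>
            limitin (Euclidean_space (m j)) (\<lambda>k. u2 (w j k)) (u2 (wbar j))
              (inf sequentially (principal I))) \<and>
         pos_lin_indep (IB J m g xbar <+> (I0 J g xbar <+> I0 J g xbar))
           (wr_family m g xbar wbar)))"

end

theory Submission
  imports Defs
begin

text \<open>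
  Fix a constraint \<open>j\<close> and write \<open>A\<close> for the Jacobian of \<open>g j\<close> at \<open>xbar\<close>, with first row
  \<open>A\<^sub>0\<close> and remaining rows forming \<open>B\<close>. If \<open>g j xbar\<close> is a nonzero boundary point of the cone,
  then \<open>\<Gamma> y\<close> is a positive multiple of the eigenvector \<open>u\<^sub>1(y)\<close> at \<open>y = g j xbar\<close>, so Robinson's
  condition says that one member of the weak-Robinson family is nonzero. In the interior it is
  vacuous.

  The case of substance is \<open>g j xbar = 0\<close>. Suppose that \<open>A\<^sup>T v = 0\<close> for some nonzero
  \<open>v = (a, s)\<close> in the cone. The part of \<open>s\<close> orthogonal to the range of \<open>B\<close> is killed by
  \<open>B\<^sup>T\<close>, so \<open>s\<close> may be replaced by its orthogonal projection \<open>p = B d\<close> onto that range: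
  still \<open>A\<^sup>T (a, p) = 0\<close>, and \<open>\<parallel>p\<parallel> \<le> \<parallel>s\<parallel> \<le> a\<close> keeps the vector in the cone
  (\<open>projection_onto_row_values\<close>). The gain is that \<open>p\<close> is a directional derivative: along
  \<open>x\<^sub>k = xbar + d/(k+1)\<close> the rescaled values of \<open>g j\<close> have hat part tending to \<open>p\<close>, so every
  limit direction \<open>w\<close> of eigenvectors along this sequence satisfies \<open>\<parallel>p\<parallel> w = p\<close>
  (\<open>eigendirection_limit\<close>). Hence \<open>(a, p)\<close> is the combination of \<open>(1, -w)\<close> and \<open>(1, w)\<close>
  with the nonnegative coefficients \<open>(a \<mp> \<parallel>p\<parallel>)/2\<close>, whose sum is \<open>a > 0\<close>. Since
  \<open>A\<^sup>T (a, p) = 0\<close>, this contradicts positive linear independence.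
\<close>

section \<open>Second-order cones in coordinates\<close>

lemma topspace_Euclidean_space_iff:
  "y \<in> topspace (Euclidean_space m) \<longleftrightarrow> (\<forall>i\<ge>m. y i = 0)"
  by (auto simp: topspace_Euclidean_space)

lemma continuous_map_Euclidean_space_component:
  "continuous_map (Euclidean_space m) euclideanreal (\<lambda>y. y i)"
  unfolding Euclidean_space_def
  by (intro continuous_map_from_subtopology continuous_map_product_projection) simp

lemma limitin_Euclidean_space_component:
  assumes "limitin (Euclidean_space m) X l F"
  shows "((\<lambda>k. X k i) \<longlongrightarrow> l i) F"
  using continuous_map_limit[OF continuous_map_Euclidean_space_component assms, of i]
  by (simp add: o_def)

lemma enorm_hat_pos:
  assumes "y \<in> topspace (Euclidean_space m)" and "hat y \<noteq> (\<lambda>_. 0)"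
  shows "enorm (m - 1) (hat y) > 0"
proof -
  obtain i where i: "y (Suc i) \<noteq> 0"
    using assms(2) by (auto simp: hat_def)
  then have "\<not> m \<le> Suc i"
    using assms(1) by (auto simp: topspace_Euclidean_space_iff)
  then have "i < m - 1"
    by simp
  then have "enorm (m - 1) (hat y) \<noteq> 0"
    using i by (auto simp: enorm_def L2_set_eq_0_iff hat_def)
  then show ?thesis
    using L2_set_nonneg[of "hat y" "{..<m - 1}"] unfolding enorm_def by linarith
qed

text \<open>
  Points where the defining inequality is strict form an open subset of the cone, so they are
  not in its frontier.
\<close>

lemma soc_frontier_active:
  assumes y: "y \<in> soc m" and front: "y \<in> Euclidean_space m frontier_of soc m"
  shows "y 0 = enorm (m - 1) (hat y)"
proof (rule ccontr)
  assume "y 0 \<noteq> enorm (m - 1) (hat y)"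
  then have strict: "enorm (m - 1) (hat y) < y 0"
    using y by (simp add: soc_def)
  let ?U = "{z \<in> topspace (Euclidean_space m). z 0 - enorm (m - 1) (hat z) \<in> {0<..}}"
  have "continuous_map (Euclidean_space m) euclideanreal (\<lambda>z. z 0 - enorm (m - 1) (hat z))"
    unfolding enorm_def L2_set_def hat_def
    by (intro continuous_intros continuous_map_Euclidean_space_component) auto
  then have "openin (Euclidean_space m) ?U"
    by (rule openin_continuous_map_preimage) simp
  moreover have "?U \<subseteq> soc m"
    by (auto simp: soc_def)
  moreover have "y \<in> ?U"
    using strict y by (simp add: soc_def)
  ultimately have "y \<in> Euclidean_space m interior_of soc m"
    using interior_of_maximal by blast
  then show False
    using front by (simp add: frontier_of_def)
qed

lemma soc_head_pos:
  assumes "y \<in> soc m" and "y \<noteq> (\<lambda>_. 0)"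
  shows "y 0 > 0"
proof (cases "hat y = (\<lambda>_. 0)")
  case True
  have "y 0 \<noteq> 0"
  proof
    assume "y 0 = 0"
    then have "y i = 0" for i
      using True by (cases i) (auto simp: hat_def fun_eq_iff)
    then show False
      using assms(2) by auto
  qed
  moreover have "enorm (m - 1) (hat y) \<ge> 0"
    by (simp add: enorm_def)
  ultimately show ?thesis
    using assms(1) by (simp add: soc_def)
next
  case False
  then show ?thesis
    using assms(1) enorm_hat_pos[of y m] by (simp add: soc_def)
qed

text \<open>
  On the boundary \<open>y 0\<close> equals the norm of \<^term>\<open>hat y\<close>, so reflecting the hat part and
  normalising it differ only by this factor.
\<close>

lemma Gamma_boundary_eq_eigenvector:
  assumes "y \<in> soc m" and "y \<in> soc_bd_plus m" and "i < m"
  shows "Gamma_mult m y i = 2 * y 0 * u1 (normalized_hat m y) i"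
proof -
  have act: "y 0 = enorm (m - 1) (hat y)" and pos: "y 0 > 0"
    using assms soc_frontier_active soc_head_pos by (auto simp: soc_bd_plus_def)
  have "Gamma_mult m y i = (if i = 0 then y 0 else - y i)"
  proof -
    have "Gamma_mult m y i = (\<Sum>l<m. if l = i then Gamma_mat i i * y i else 0)"
      unfolding Gamma_mult_def by (intro sum.cong) (auto simp: Gamma_mat_def)
    then show ?thesis
      using assms(3) by (simp add: Gamma_mat_def)
  qed
  then show ?thesis
    using act pos by (cases i) (auto simp: u1_def normalized_hat_def hat_def)
qed

section \<open>Transposed Jacobians\<close>

lemma JacT_mult_eq_sum: "JacT_mult m G x v = (\<Sum>i<m. v i *\<^sub>R Jac G x i)"
  by (simp add: JacT_mult_def vec_eq_iff mult.commute)

lemma JacT_mult_scaled: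
  assumes "\<And>i. i < m \<Longrightarrow> v i = c * u i"
  shows "JacT_mult m G x v = c *\<^sub>R JacT_mult m G x u"
  using assms by (simp add: JacT_mult_eq_sum scaleR_sum_right)

lemma JacT_mult_split:
  assumes "m \<ge> 1"
  shows "JacT_mult m G x v =
    v 0 *\<^sub>R Jac G x 0 + (\<Sum>i<m - 1. hat v i *\<^sub>R Jac G x (Suc i))"
proof -
  obtain n where "m = Suc n"
    using assms by (cases m) auto
  then show ?thesis
    by (simp add: JacT_mult_eq_sum sum.lessThan_Suc_shift hat_def del: sum.lessThan_Suc)
qed

lemma frechet_derivative_eq_grad:
  assumes "h differentiable (at x)"
  shows "frechet_derivative h (at x) d = grad h x \<bullet> d"
proof -
  have lin: "linear (frechet_derivative h (at x))"
    using assms by (rule linear_frechet_derivative)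
  have "frechet_derivative h (at x) d
      = frechet_derivative h (at x) (\<Sum>k\<in>UNIV. (d $ k) *\<^sub>R axis k 1)"
    using basis_expansion[of d] by (simp add: scalar_mult_eq_scaleR)
  also have "\<dots> = (\<Sum>k\<in>UNIV. d $ k * frechet_derivative h (at x) (axis k 1))"
    using lin by (simp add: linear_sum linear_scale)
  finally show ?thesis
    by (simp add: grad_def inner_vec_def mult.commute)
qed

lemma directional_difference_quotient:
  fixes x d :: "real^'n"
  assumes "h differentiable (at x)" and "h x = 0"
  shows "(\<lambda>k. real (Suc k) * h (x + inverse (real (Suc k)) *\<^sub>R d)) \<longlonglongrightarrow> grad h x \<bullet> d"
proof -
  have "(h has_derivative (\<lambda>v. grad h x \<bullet> v)) (at (x + 0 *\<^sub>R d))"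
    using assms(1)
    by (simp add: frechet_derivative_works frechet_derivative_eq_grad[OF assms(1), symmetric])
  then have "((\<lambda>t. h (x + t *\<^sub>R d)) has_derivative (\<lambda>t. grad h x \<bullet> (t *\<^sub>R d))) (at 0)"
    by (rule has_derivative_compose[rotated]) (auto intro!: derivative_eq_intros)
  then have "((\<lambda>t. h (x + t *\<^sub>R d)) has_field_derivative grad h x \<bullet> d) (at 0)"
    by (simp add: has_field_derivative_def mult.commute[of "grad h x \<bullet> d", abs_def])
  then have "((\<lambda>t. h (x + t *\<^sub>R d) / t) \<longlongrightarrow> grad h x \<bullet> d) (at 0)"
    using assms(2) by (simp add: DERIV_def)
  moreover have "filterlim (\<lambda>k. inverse (real (Suc k))) (at 0) sequentially"
    using LIMSEQ_inverse_real_of_nat by (auto simp: filterlim_at)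
  ultimately have "((\<lambda>k. h (x + inverse (real (Suc k)) *\<^sub>R d) / inverse (real (Suc k)))
      \<longlongrightarrow> grad h x \<bullet> d) sequentially"
    by (rule filterlim_compose)
  then show ?thesis
    by (simp add: field_simps)
qed

section \<open>Replacing a multiplier by a directional derivative\<close>

text \<open>
  The numbers \<open>b i \<bullet> d\<close> form the orthogonal projection of \<open>v\<close> onto the range of the matrix
  with rows \<open>b i\<close>. They are obtained from the normal equations, whose operator
  \<open>T d = (\<Sum>i\<in>S. (b i \<bullet> d) b i)\<close> satisfies \<open>T z \<bullet> z = (\<Sum>i\<in>S. (b i \<bullet> z)\<^sup>2)\<close>: what is
  orthogonal to its range is orthogonal to every row, and so to the right-hand side.
\<close>

lemma projection_onto_row_values:
  fixes b :: "'i \<Rightarrow> 'a::euclidean_space" and v :: "'i \<Rightarrow> real"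
  assumes fin: "finite S"
  obtains d where "(\<Sum>i\<in>S. (b i \<bullet> d) *\<^sub>R b i) = (\<Sum>i\<in>S. v i *\<^sub>R b i)"
    and "L2_set (\<lambda>i. b i \<bullet> d) S \<le> L2_set v S"
proof -
  define T where "T d = (\<Sum>i\<in>S. (b i \<bullet> d) *\<^sub>R b i)" for d
  define u where "u = (\<Sum>i\<in>S. v i *\<^sub>R b i)"
  have lin: "linear T"
    unfolding T_def
    by (intro linear_compose_sum ballI linearI) (auto simp: inner_add_right scaleR_add_left)
  then have "span (range T) = range T"
    by (simp add: linear_subspace_image span_eq_iff)
  then obtain d z where u: "u = T d + z" and orth: "\<And>e. orthogonal z (T e)"
    using orthogonal_subspace_decomp_exists[of "range T" u] by (metis imageE rangeI)
  have "(\<Sum>i\<in>S. (b i \<bullet> z)\<^sup>2) = 0"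
    using orth[of z] by (simp add: orthogonal_def T_def inner_sum_right power2_eq_square
        inner_commute)
  then have row: "b i \<bullet> z = 0" if "i \<in> S" for i
    using fin that by (simp add: sum_nonneg_eq_0_iff)
  then have "u \<bullet> z = 0"
    by (simp add: u_def inner_sum_left)
  moreover have "T d \<bullet> z = 0"
    using orth[of d] by (simp add: orthogonal_def inner_commute)
  ultimately have "z \<bullet> z = 0"
    unfolding u by (simp add: inner_add_left)
  then have "z = 0"
    by simp
  then have eq: "T d = u"
    using u by simp
  have "(\<Sum>i\<in>S. (b i \<bullet> d)\<^sup>2) = (\<Sum>i\<in>S. v i * (b i \<bullet> d))"
    using arg_cong[OF eq, of "\<lambda>e. e \<bullet> d"]
    by (simp add: T_def u_def inner_sum_left power2_eq_square)
  moreover have "0 \<le> (\<Sum>i\<in>S. (v i - b i \<bullet> d)\<^sup>2)"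
    by (intro sum_nonneg) simp
  moreover have "(\<Sum>i\<in>S. (v i - b i \<bullet> d)\<^sup>2)
      = (\<Sum>i\<in>S. (v i)\<^sup>2) - 2 * (\<Sum>i\<in>S. v i * (b i \<bullet> d)) + (\<Sum>i\<in>S. (b i \<bullet> d)\<^sup>2)"
    by (simp add: power2_diff sum.distrib sum_subtractf sum_distrib_left mult.assoc)
  ultimately have "L2_set (\<lambda>i. b i \<bullet> d) S \<le> L2_set v S"
    by (simp add: L2_set_def)
  then show ?thesis
    using that eq by (simp add: T_def u_def)
qed

section \<open>Limit directions of eigenvectors\<close>

text \<open>
  This identity covers both cases in the choice of eigenvectors at once: for a vanishing hat
  part both sides are zero, whatever direction was chosen.
\<close>

lemma eig_dirs_polar:
  assumes "y \<in> topspace (Euclidean_space m)" and "w \<in> eig_dirs m y"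
  shows "enorm (m - 1) (hat y) * w i = hat y i"
proof (cases "hat y = (\<lambda>_. 0)")
  case True
  then show ?thesis
    by (simp add: enorm_def L2_set_def)
next
  case False
  then show ?thesis
    using assms enorm_hat_pos[OF assms(1)] by (simp add: eig_dirs_def normalized_hat_def)
qed

text \<open>
  Rescaling by \<open>k + 1\<close> turns the polar identity for \<open>G\<close> at \<open>x + d/(k+1)\<close> into one
  between convergent quantities, because \<open>G x = 0\<close> makes the rescaled values difference
  quotients. The conclusion pins down \<open>wbar\<close> when the directional
  derivative is nonzero and is trivial otherwise.
\<close>

lemma eigendirection_limit:
  fixes G :: "real^'n \<Rightarrow> nat \<Rightarrow> real"
  assumes G: "cont_diff_map m G" and zero: "G x = (\<lambda>_. 0)"
    and I: "infinite I"
    and dirs: "\<And>k. k \<in> I \<Longrightarrow> w k \<in> eig_dirs m (G (x + inverse (real (Suc k)) *\<^sub>R d))"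
    and lim: "limitin (Euclidean_space m) (\<lambda>k. u2 (w k)) (u2 wbar)
      (inf sequentially (principal I))"
    and i: "i < m - 1"
  shows "L2_set (\<lambda>l. Jac G x (Suc l) \<bullet> d) {..<m - 1} * wbar i = Jac G x (Suc i) \<bullet> d"
proof -
  let ?F = "inf sequentially (principal I)"
  define y where "y k = hat (G (x + inverse (real (Suc k)) *\<^sub>R d))" for k
  have nontriv: "?F \<noteq> bot"
    using I unfolding trivial_limit_def eventually_inf_principal eventually_sequentially
    by (metis finite_nat_set_iff_bounded not_le)
  have comp: "((\<lambda>k. real (Suc k) * y k l) \<longlongrightarrow> Jac G x (Suc l) \<bullet> d) ?F" if "l < m - 1" for l
  proof -
    have "(\<lambda>z. G z (Suc l)) differentiable (at x)"
      using G that by (simp add: cont_diff_map_def cont_diff_def)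
    then have "(\<lambda>k. real (Suc k) * y k l) \<longlonglongrightarrow> Jac G x (Suc l) \<bullet> d"
      using directional_difference_quotient[of "\<lambda>z. G z (Suc l)" x d] zero
      by (simp add: Jac_def y_def hat_def)
    then show ?thesis
      by (rule tendsto_mono[rotated]) simp
  qed
  have "((\<lambda>k. L2_set (\<lambda>l. real (Suc k) * y k l) {..<m - 1})
      \<longlongrightarrow> L2_set (\<lambda>l. Jac G x (Suc l) \<bullet> d) {..<m - 1}) ?F"
    unfolding L2_set_def by (intro tendsto_intros comp) auto
  moreover have "((\<lambda>k. w k i) \<longlongrightarrow> wbar i) ?F"
    using tendsto_mult_left[OF limitin_Euclidean_space_component[OF lim, of "Suc i"], of 2]
    by (simp add: u2_def)
  ultimately have "((\<lambda>k. L2_set (\<lambda>l. real (Suc k) * y k l) {..<m - 1} * w k i)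
      \<longlongrightarrow> L2_set (\<lambda>l. Jac G x (Suc l) \<bullet> d) {..<m - 1} * wbar i) ?F"
    by (rule tendsto_mult)
  moreover have "\<forall>\<^sub>F k in ?F.
      L2_set (\<lambda>l. real (Suc k) * y k l) {..<m - 1} * w k i = real (Suc k) * y k i"
  proof -
    have "L2_set (\<lambda>l. real (Suc k) * y k l) {..<m - 1} * w k i = real (Suc k) * y k i"
      if "k \<in> I" for k
      using eig_dirs_polar[OF _ dirs[OF that], of i] G
      by (simp add: L2_set_left_distrib[symmetric] L2_set_right_distrib[symmetric]
          cont_diff_map_def y_def enorm_def mult.assoc)
    then show ?thesis
      by (simp add: eventually_inf_principal)
  qed
  ultimately have "((\<lambda>k. real (Suc k) * y k i)
      \<longlongrightarrow> L2_set (\<lambda>l. Jac G x (Suc l) \<bullet> d) {..<m - 1} * wbar i) ?F"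
    by (rule Lim_transform_eventually)
  then show ?thesis
    using tendsto_unique[OF nontriv] comp[OF i] by blast
qed

section \<open>Isolated constraints\<close>

lemma pos_lin_indep_subset:
  assumes "pos_lin_indep S V" and "finite S" and "R \<subseteq> S"
  shows "pos_lin_indep R V"
  unfolding pos_lin_indep_def
proof (intro allI impI)
  fix c :: "'a \<Rightarrow> real"
  assume c: "(\<forall>s\<in>R. c s \<ge> 0) \<and> (\<Sum>s\<in>R. c s *\<^sub>R V s) = 0"
  define e where "e s = (if s \<in> R then c s else 0)" for s
  have "(\<Sum>s\<in>S. e s *\<^sub>R V s) = (\<Sum>s\<in>R. c s *\<^sub>R V s)"
    using assms(2,3) by (intro sum.mono_neutral_cong_right) (auto simp: e_def)
  then have "(\<Sum>s\<in>S. e s *\<^sub>R V s) = 0"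
    using c by simp
  moreover have "\<forall>s\<in>S. e s \<ge> 0"
    using c by (simp add: e_def)
  ultimately have "\<forall>s\<in>S. e s = 0"
    using assms(1) unfolding pos_lin_indep_def by blast
  then show "\<forall>s\<in>R. c s = 0"
    using assms(3) by (metis e_def subsetD)
qed

text \<open>
  The family members at boundary constraints do not depend on the sequence, so the constant
  sequence suffices here.
\<close>

lemma weak_robinson_boundary_nonzero:
  assumes "weak_robinson_cq J m g xbar" and "finite J" and "j \<in> IB J m g xbar"
  shows "JacT_mult (m j) (g j) xbar (u1 (normalized_hat (m j) (g j xbar))) \<noteq> 0"
proof -
  obtain wbar where
    "pos_lin_indep (IB J m g xbar <+> (I0 J g xbar <+> I0 J g xbar)) (wr_family m g xbar wbar)"
    using assms(1) tendsto_const[of xbar sequentially] unfolding weak_robinson_cq_def by blast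
  moreover have "finite (IB J m g xbar <+> (I0 J g xbar <+> I0 J g xbar))"
    using assms(2) by (simp add: IB_def I0_def)
  ultimately have "pos_lin_indep {Inl j} (wr_family m g xbar wbar)"
    using assms(3) by (elim pos_lin_indep_subset) auto
  then show ?thesis
    by (auto simp: pos_lin_indep_def wr_family_def dest: spec[of _ "\<lambda>_. 1"])
qed

text \<open>
  The sequence approaches \<open>xbar\<close> along a direction \<open>d\<close> chosen from the multiplier itself, which
  forces the projected hat part of \<open>v\<close> to be a nonnegative multiple of \<open>wbar j\<close>. The
  projected multiplier then lies in the cone spanned by the two vectors \<open>(1, \<mp> wbar j)\<close>.
\<close>

lemma weak_robinson_vertex_multiplier_zero:
  fixes g :: "nat \<Rightarrow> real^'n \<Rightarrow> nat \<Rightarrow> real"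
  assumes wr: "weak_robinson_cq J m g xbar" and "finite J"
    and j: "j \<in> I0 J g xbar" and m: "m j \<ge> 1" and G: "cont_diff_map (m j) (g j)"
    and v: "v \<in> soc (m j)" and ker: "JacT_mult (m j) (g j) xbar v = 0"
  shows "v = (\<lambda>_. 0)"
proof (rule ccontr)
  assume "v \<noteq> (\<lambda>_. 0)"
  then have pos: "v 0 > 0"
    using soc_head_pos[OF v] by simp
  let ?n = "m j - 1"
  let ?b = "\<lambda>i. Jac (g j) xbar (Suc i)"
  obtain d where d: "(\<Sum>i<?n. (?b i \<bullet> d) *\<^sub>R ?b i) = (\<Sum>i<?n. hat v i *\<^sub>R ?b i)"
    and le: "L2_set (\<lambda>i. ?b i \<bullet> d) {..<?n} \<le> L2_set (hat v) {..<?n}"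
    using projection_onto_row_values[of "{..<?n}" ?b "hat v"] by auto
  define r where "r = L2_set (\<lambda>i. ?b i \<bullet> d) {..<?n}"
  have "r \<ge> 0"
    by (simp add: r_def)
  have "r \<le> v 0"
    using le v by (simp add: r_def soc_def enorm_def)
  have "(\<lambda>k. xbar + inverse (real (Suc k)) *\<^sub>R d) \<longlonglongrightarrow> xbar + 0 *\<^sub>R d"
    by (intro tendsto_intros LIMSEQ_inverse_real_of_nat)
  then have conv: "(\<lambda>k. xbar + inverse (real (Suc k)) *\<^sub>R d) \<longlonglongrightarrow> xbar"
    by simp
  obtain I w wbar where "infinite I"
    and "\<forall>k\<in>I. w j k \<in> eig_dirs (m j) (g j (xbar + inverse (real (Suc k)) *\<^sub>R d))"
    and "limitin (Euclidean_space (m j)) (\<lambda>k. u2 (w j k)) (u2 (wbar j))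
      (inf sequentially (principal I))"
    and indep: "pos_lin_indep (IB J m g xbar <+> (I0 J g xbar <+> I0 J g xbar))
      (wr_family m g xbar wbar)"
    using wr[unfolded weak_robinson_cq_def, rule_format, OF conv] j by blast
  then have dir: "r * wbar j i = ?b i \<bullet> d" if "i < ?n" for i
    using eigendirection_limit[OF G, of xbar I "w j" d "wbar j" i] j that
    by (simp add: I0_def r_def)
  let ?R = "{Inr (Inl j), Inr (Inr j)} :: (nat + nat + nat) set"
  have "finite (IB J m g xbar <+> (I0 J g xbar <+> I0 J g xbar))"
    using \<open>finite J\<close> by (simp add: IB_def I0_def)
  then have indep2: "pos_lin_indep ?R (wr_family m g xbar wbar)"
    using indep j by (elim pos_lin_indep_subset) auto
  \<comment> \<open>These coefficients solve \<open>\<alpha> (1, -w) + \<beta> (1, w) = (v 0, r w)\<close>.\<close>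
  define c :: "nat + nat + nat \<Rightarrow> real"
    where "c = case_sum (\<lambda>_. 0) (case_sum (\<lambda>_. (v 0 - r) / 2) (\<lambda>_. (v 0 + r) / 2))"
  let ?W = "\<Sum>i<?n. wbar j i *\<^sub>R ?b i"
  have "(\<Sum>s\<in>?R. c s *\<^sub>R wr_family m g xbar wbar s)
      = ((v 0 - r) / 2) *\<^sub>R (Jac (g j) xbar 0 - ?W) + ((v 0 + r) / 2) *\<^sub>R (Jac (g j) xbar 0 + ?W)"
    by (simp add: c_def wr_family_def JacT_mult_split[OF m] hat_def sum_negf)
  also have "\<dots> = (((v 0 - r) / 2) + ((v 0 + r) / 2)) *\<^sub>R Jac (g j) xbar 0
      + (((v 0 + r) / 2) - ((v 0 - r) / 2)) *\<^sub>R ?W"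
    by (simp only: scaleR_add_left scaleR_diff_left scaleR_add_right scaleR_diff_right) simp
  also have "\<dots> = v 0 *\<^sub>R Jac (g j) xbar 0 + r *\<^sub>R ?W"
    by (simp add: field_simps)
  also have "r *\<^sub>R ?W = (\<Sum>i<?n. hat v i *\<^sub>R ?b i)"
    using dir d by (simp add: scaleR_sum_right)
  also have "v 0 *\<^sub>R Jac (g j) xbar 0 + (\<Sum>i<?n. hat v i *\<^sub>R ?b i) = 0"
    using ker by (simp add: JacT_mult_split[OF m])
  finally have "(\<Sum>s\<in>?R. c s *\<^sub>R wr_family m g xbar wbar s) = 0" .
  moreover have "\<forall>s\<in>?R. c s \<ge> 0"
    using \<open>r \<ge> 0\<close> \<open>r \<le> v 0\<close> by (simp add: c_def)
  ultimately have "\<forall>s\<in>?R. c s = 0"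
    using indep2 unfolding pos_lin_indep_def by blast
  then show False
    using \<open>r \<ge> 0\<close> pos by (simp add: c_def)
qed

theorem theorem3p1:
  fixes f :: "real^'n \<Rightarrow> real"
    and g :: "nat \<Rightarrow> real^'n \<Rightarrow> nat \<Rightarrow> real"
    and m :: "nat \<Rightarrow> nat"
    and q :: nat
    and xbar :: "real^'n"
  assumes "cont_diff f"
    and "\<forall>j\<in>{1..q}. m j \<ge> 2"
    and "\<forall>j\<in>{1..q}. cont_diff_map (m j) (g j)"
    and "feasible {1..q} m g xbar"
    and "weak_robinson_cq {1..q} m g xbar"
  shows "\<forall>j\<in>{1..q}. robinson_cq {j} m g xbar"
proof
  fix j assume j: "j \<in> {1..q}"
  let ?y = "g j xbar"
  have soc: "?y \<in> soc (m j)"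
    using assms(4) j by (simp add: feasible_def)
  consider (vertex) "?y = (\<lambda>_. 0)" | (boundary) "?y \<in> soc_bd_plus (m j)"
    | (inside) "?y \<noteq> (\<lambda>_. 0)" "?y \<notin> soc_bd_plus (m j)"
    by blast
  then show "robinson_cq {j} m g xbar"
  proof cases
    case vertex
    then have "I0 {j} g xbar = {j}" and "IB {j} m g xbar = {}"
      by (auto simp: I0_def IB_def soc_bd_plus_def)
    moreover have "v = (\<lambda>_. 0)" if "v \<in> soc (m j)" and "JacT_mult (m j) (g j) xbar v = 0" for v
      using weak_robinson_vertex_multiplier_zero[OF assms(5), of j v] assms(2,3) j vertex that
      by (force simp: I0_def)
    ultimately show ?thesis
      by (simp add: robinson_cq_def)
  next
    case boundary
    then have sets: "I0 {j} g xbar = {}" "IB {j} m g xbar = {j}"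
      by (auto simp: I0_def IB_def soc_bd_plus_def)
    have "JacT_mult (m j) (g j) xbar (Gamma_mult (m j) ?y)
        = (2 * ?y 0) *\<^sub>R JacT_mult (m j) (g j) xbar (u1 (normalized_hat (m j) ?y))"
      by (rule JacT_mult_scaled) (rule Gamma_boundary_eq_eigenvector[OF soc boundary])
    moreover have "?y 0 > 0"
      using soc_head_pos[OF soc] boundary by (simp add: soc_bd_plus_def)
    moreover have "JacT_mult (m j) (g j) xbar (u1 (normalized_hat (m j) ?y)) \<noteq> 0"
      using weak_robinson_boundary_nonzero[OF assms(5), of j] j boundary by (simp add: IB_def)
    ultimately show ?thesis
      by (simp add: robinson_cq_def sets)
  next
    case inside
    then show ?thesis
      by (simp add: robinson_cq_def I0_def IB_def)
  qed
qed

end
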